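(* Let $F=F(q)$ be a smooth function on an open interval with $F''(q)>0$, and write $F''(q)=e^{G(q)}$ and $I(q)=2G'(q)$, so that $F(q)=\iint e^{\int \frac{I(q)}{2}\,dq}\,dq\,dq$. Then $F$ satisfies the $6^{\text{th}}$ order nonlinear ODE $$10 F^{(6)}(F'')^3-80(F'')^2F^{(3)} F^{(5)}-51(F'')^2(F^{(4)})^2+336 F'' (F^{(3)})^2F^{(4)}-224(F^{(3)})^4=0$$ if and only if $I$ satisfies the generalised Chazy equation with Chazy parameter $k^2=\left(\tfrac23\right)^2=\tfrac49$, namely $$I'''-2 I'' I+3 (I')^2-\frac{4}{36-\left(\frac{2}{3}\right)^2} \big(6 I' -I^2\big)^2=0.$$
   Context: Primes and superscripts in parentheses denote derivatives with respect to $q$. The generalised Chazy equation with Chazy parameter $k$ ($k\neq\pm6$) for $y(x)$ is $y'''-2yy''+3(y')^2-\frac{4}{36-k^2}(6y'-y^2)^2=0$. *)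

theory Defs
  imports "HOL-Analysis.Analysis"
begin

definition smooth_on :: "real set \<Rightarrow> (real \<Rightarrow> real) \<Rightarrow> bool"
  where "smooth_on S f \<longleftrightarrow> (\<forall>n. \<forall>q\<in>S. (deriv ^^ n) f differentiable (at q))"

text \<open>The indefinite integral \<open>f = \<integral> g dq\<close> on \<open>S\<close>, with an arbitrary constant of integration.\<close>

definition antiderivative_on :: "real set \<Rightarrow> (real \<Rightarrow> real) \<Rightarrow> (real \<Rightarrow> real) \<Rightarrow> bool"
  where "antiderivative_on S f g \<longleftrightarrow> (\<forall>q\<in>S. (f has_real_derivative g q) (at q))"

text \<open>
  Since \<^const>\<open>deriv\<close> is total, a solution is explicitly required to be three times
  differentiable; \<open>k \<noteq> \<plusminus>6\<close> excludes a division by zero.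
\<close>

definition generalised_chazy :: "real \<Rightarrow> real set \<Rightarrow> (real \<Rightarrow> real) \<Rightarrow> bool"
  where "generalised_chazy k S y \<longleftrightarrow>
    k \<noteq> 6 \<and> k \<noteq> - 6 \<and>
    (\<forall>n<3. \<forall>x\<in>S. (deriv ^^ n) y differentiable (at x)) \<and>
    (\<forall>x\<in>S. (deriv ^^ 3) y x - 2 * y x * (deriv ^^ 2) y x + 3 * (deriv y x)^2
       - 4 / (36 - k^2) * (6 * deriv y x - (y x)^2)^2 = 0)"

end

theory Submission imports Defs begin

text \<open>
  Only the ratios \<open>r\<^sub>n = F\<^sup>(\<^sup>n\<^sup>+\<^sup>2\<^sup>) / F''\<close> matter. The equation for \<open>F\<close> is homogeneous of degree 4 in
  the derivatives of \<open>F\<close>, so dividing by \<open>(F'')\<^sup>4\<close> turns it into the polynomial equation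
  \<open>10 r\<^sub>4 - 80 r\<^sub>1 r\<^sub>3 - 51 r\<^sub>2\<^sup>2 + 336 r\<^sub>1\<^sup>2 r\<^sub>2 - 224 r\<^sub>1\<^sup>4 = 0\<close>. On the other side, \<open>G = ln F''\<close> gives
  \<open>I = 2 r\<^sub>1\<close>, and the rule \<open>r\<^sub>n' = r\<^sub>n\<^sub>+\<^sub>1 - r\<^sub>n r\<^sub>1\<close> (\<open>has_real_derivative_ratio\<close>)
  expresses \<open>I'\<close>, \<open>I''\<close> and \<open>I'''\<close> as polynomials in \<open>r\<^sub>1, \<dots>, r\<^sub>4\<close>
  (\<open>has_real_derivative_log_deriv_poly\<close>). For \<open>k\<^sup>2 = 4/9\<close> the Chazy constant is
  \<open>4 / (36 - k\<^sup>2) = 9/80\<close>, and substitution shows that five times the Chazy expression in \<open>I\<close> is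
  exactly the polynomial above (\<open>sextic_eq_chazy\<close>). Hence the equation for \<open>F\<close> is the Chazy
  equation multiplied by \<open>5 (F'')\<^sup>4\<close>, which does not vanish; the equivalence holds pointwise.

  The representation of \<open>F\<close> as an iterated integral is witnessed by \<open>G\<close> and \<open>F'\<close>. Since \<open>G\<close> agrees
  with \<open>ln F''\<close> on the open set \<open>S\<close>, it is differentiable there, and so is \<open>I\<close> as often as needed.
\<close>

text \<open>
  Openness lets an identity on \<open>S\<close> be differentiated, so a chain of derivatives known only on \<open>S\<close>
  determines the iterated total derivative there.
\<close>

lemma iterated_deriv_eq_on_open:
  fixes y :: "real \<Rightarrow> real" and e :: "nat \<Rightarrow> real \<Rightarrow> real"
  assumes "open S"
    and base: "\<And>q. q \<in> S \<Longrightarrow> y q = e 0 q"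
    and step: "\<And>n q. n < N \<Longrightarrow> q \<in> S \<Longrightarrow> (e n has_real_derivative e (Suc n) q) (at q)"
    and "n \<le> N" "q \<in> S"
  shows "(deriv ^^ n) y q = e n q"
  using \<open>n \<le> N\<close> \<open>q \<in> S\<close>
proof (induction n arbitrary: q)
  case 0
  then show ?case by (simp add: base)
next
  case (Suc n)
  have "(e n has_real_derivative e (Suc n) q) (at q)"
    using Suc.prems step by simp
  then have "((deriv ^^ n) y has_real_derivative e (Suc n) q) (at q)"
    by (rule has_field_derivative_transform_within_open[OF _ \<open>open S\<close> \<open>q \<in> S\<close>])
       (use Suc in simp)
  then show ?case by (simp add: DERIV_imp_deriv)
qed

lemma iterated_deriv_differentiable_on_open:
  fixes y :: "real \<Rightarrow> real" and e :: "nat \<Rightarrow> real \<Rightarrow> real"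
  assumes "open S"
    and base: "\<And>q. q \<in> S \<Longrightarrow> y q = e 0 q"
    and step: "\<And>n q. n < N \<Longrightarrow> q \<in> S \<Longrightarrow> (e n has_real_derivative e (Suc n) q) (at q)"
    and "n < N" "q \<in> S"
  shows "(deriv ^^ n) y differentiable (at q)"
proof -
  have "((deriv ^^ n) y has_real_derivative e (Suc n) q) (at q)"
    using step[OF \<open>n < N\<close> \<open>q \<in> S\<close>]
    by (rule has_field_derivative_transform_within_open[OF _ \<open>open S\<close> \<open>q \<in> S\<close>])
       (use iterated_deriv_eq_on_open[OF assms(1) base step, of N n] \<open>n < N\<close> in simp)
  then show ?thesis
    using real_differentiable_def by blast
qed

lemma smooth_on_has_real_derivative:
  assumes "smooth_on S F" "q \<in> S"
  shows "((deriv ^^ n) F has_real_derivative (deriv ^^ Suc n) F q) (at q)"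
  using assms by (simp add: smooth_on_def DERIV_deriv_iff_real_differentiable)

lemma has_real_derivative_ratio:
  fixes d :: "nat \<Rightarrow> real \<Rightarrow> real"
  assumes "\<And>n. (d n has_real_derivative d (Suc n) q) (at q)" "d 0 q \<noteq> 0"
  shows "((\<lambda>x. d n x / d 0 x) has_real_derivative
           d (Suc n) q / d 0 q - d n q / d 0 q * (d (Suc 0) q / d 0 q)) (at q)"
  using assms(2)
  by (auto intro!: derivative_eq_intros assms(1) simp: field_simps)

text \<open>
  The polynomials in \<open>r\<^sub>1, \<dots>, r\<^sub>4\<close> representing twice the logarithmic derivative of \<open>F''\<close> and its first
  three derivatives. Only indices up to 3 carry meaning; larger ones repeat the value at 3.
\<close>

fun log_deriv_poly :: "(nat \<Rightarrow> real) \<Rightarrow> nat \<Rightarrow> real" where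
  "log_deriv_poly r 0 = 2 * r 1"
| "log_deriv_poly r (Suc 0) = 2 * (r 2 - r 1 ^ 2)"
| "log_deriv_poly r (Suc (Suc 0)) = 2 * (r 3 - 3 * r 1 * r 2 + 2 * r 1 ^ 3)"
| "log_deriv_poly r (Suc (Suc (Suc _))) =
     2 * (r 4 - 4 * r 1 * r 3 - 3 * r 2 ^ 2 + 12 * r 1 ^ 2 * r 2 - 6 * r 1 ^ 4)"

lemma has_real_derivative_log_deriv_poly:
  fixes r :: "nat \<Rightarrow> real \<Rightarrow> real"
  assumes r: "\<And>n. (r n has_real_derivative r (Suc n) q - r n q * r 1 q) (at q)" and "n < 3"
  shows "((\<lambda>x. log_deriv_poly (\<lambda>m. r m x) n) has_real_derivative
           log_deriv_poly (\<lambda>m. r m q) (Suc n)) (at q)"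
proof -
  have r1: "(r 1 has_real_derivative r 2 q - r 1 q * r 1 q) (at q)"
    and r2: "(r 2 has_real_derivative r 3 q - r 2 q * r 1 q) (at q)"
    and r3: "(r 3 has_real_derivative r 4 q - r 3 q * r 1 q) (at q)"
    using r[of 1] r[of 2] r[of 3] by (simp_all add: eval_nat_numeral)
  consider "n = 0" | "n = Suc 0" | "n = Suc (Suc 0)"
    using \<open>n < 3\<close> by linarith
  then show ?thesis
  proof cases
    case 1
    then show ?thesis
      using r1 by (auto intro!: derivative_eq_intros simp: power2_eq_square)
  next
    case 2
    show ?thesis unfolding 2 log_deriv_poly.simps
      by (rule derivative_eq_intros r1 r2 refl)+ (simp add: eval_nat_numeral algebra_simps)
  next
    case 3
    show ?thesis unfolding 3 log_deriv_poly.simps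
      by (rule derivative_eq_intros r1 r2 r3 refl)+ (simp add: eval_nat_numeral algebra_simps)
  qed
qed

text \<open>
  The algebraic core: dehomogenising by \<open>d\<^sub>n = r\<^sub>n d\<^sub>0\<close> exhibits the sextic expression as the Chazy
  expression times \<open>5 d\<^sub>0\<^sup>4\<close>. The list supplies the values \<open>r\<^sub>0 = 1, r\<^sub>1, \<dots>, r\<^sub>4\<close>.
\<close>

lemma sextic_eq_chazy:
  fixes d0 r1 r2 r3 r4 :: real
  defines "p \<equiv> log_deriv_poly (\<lambda>m. [1, r1, r2, r3, r4] ! m)"
  shows "10 * (r4 * d0) * d0 ^ 3 - 80 * d0\<^sup>2 * (r1 * d0) * (r3 * d0)
           - 51 * d0\<^sup>2 * (r2 * d0)\<^sup>2 + 336 * d0 * (r1 * d0)\<^sup>2 * (r2 * d0) - 224 * (r1 * d0) ^ 4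
         = 5 * d0 ^ 4 *
           (p 3 - 2 * p 0 * p 2 + 3 * (p 1)\<^sup>2 - 4 / (36 - (2 / 3)\<^sup>2) * (6 * p 1 - (p 0)\<^sup>2)\<^sup>2)"
  unfolding p_def
  by (simp add: eval_nat_numeral) (simp add: field_simps)

theorem mainTheorem1:
  fixes F G I :: "real \<Rightarrow> real" and S :: "real set" and k :: real
  assumes "open S" and "is_interval S"
    and "smooth_on S F"
    and "\<forall>q\<in>S. (deriv ^^ 2) F q > 0"
    and "\<forall>q\<in>S. (deriv ^^ 2) F q = exp (G q)"
    and "\<forall>q\<in>S. I q = 2 * deriv G q"
    and "k^2 = (2/3)^2"
  shows "(\<exists>H K. antiderivative_on S H (\<lambda>q. I q / 2) \<and>
                antiderivative_on S K (\<lambda>q. exp (H q)) \<and>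
                antiderivative_on S F K)
    \<and> ((\<forall>q\<in>S. 10 * (deriv ^^ 6) F q * ((deriv ^^ 2) F q)^3
             - 80 * ((deriv ^^ 2) F q)^2 * (deriv ^^ 3) F q * (deriv ^^ 5) F q
             - 51 * ((deriv ^^ 2) F q)^2 * ((deriv ^^ 4) F q)^2
             + 336 * (deriv ^^ 2) F q * ((deriv ^^ 3) F q)^2 * (deriv ^^ 4) F q
             - 224 * ((deriv ^^ 3) F q)^4 = 0)
       \<longleftrightarrow> generalised_chazy k S I)"
proof -
  define d where "d n = (deriv ^^ (n + 2)) F" for n
  define r where "r n q = d n q / d 0 q" for n q
  define p where "p n q = log_deriv_poly (\<lambda>m. r m q) n" for n q
  have d: "(d n has_real_derivative d (Suc n) q) (at q)" if "q \<in> S" for n q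
    using smooth_on_has_real_derivative[OF \<open>smooth_on S F\<close> that, of "n + 2"] by (simp add: d_def)
  have d_eqs: "(deriv ^^ 2) F = d 0" "(deriv ^^ 3) F = d 1" "(deriv ^^ 4) F = d 2"
      "(deriv ^^ 5) F = d 3" "(deriv ^^ 6) F = d 4"
    by (simp_all add: d_def eval_nat_numeral)
  have pos: "d 0 q > 0" if "q \<in> S" for q
    using assms(4) that by (simp add: d_eqs)
  have r: "(r n has_real_derivative r (Suc n) q - r n q * r 1 q) (at q)" if "q \<in> S" for n q
    using has_real_derivative_ratio[of d q n, OF d[OF that]] pos[OF that]
    by (simp add: r_def[abs_def])
  have G: "(G has_real_derivative r 1 q) (at q)" if "q \<in> S" for q
  proof -
    have "((\<lambda>x. ln (d 0 x)) has_real_derivative r 1 q) (at q)"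
      using pos[OF that] d[OF that, of 0]
      by (auto intro!: derivative_eq_intros simp: r_def)
    then show ?thesis
      by (rule has_field_derivative_transform_within_open[OF _ \<open>open S\<close> that])
         (use assms(5) in \<open>simp flip: d_eqs\<close>)
  qed
  have I: "I q = p 0 q" if "q \<in> S" for q
    using DERIV_imp_deriv[OF G[OF that]] assms(6) that by (simp add: p_def)
  have p: "(p n has_real_derivative p (Suc n) q) (at q)" if "n < 3" "q \<in> S" for n q
    unfolding p_def[abs_def] by (rule has_real_derivative_log_deriv_poly[OF r[OF \<open>q \<in> S\<close>] \<open>n < 3\<close>])

  have integrals: "antiderivative_on S G (\<lambda>q. I q / 2)"
      "antiderivative_on S (deriv F) (\<lambda>q. exp (G q))" "antiderivative_on S F (deriv F)"
    using G I smooth_on_has_real_derivative[OF \<open>smooth_on S F\<close>, of _ 0]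
      smooth_on_has_real_derivative[OF \<open>smooth_on S F\<close>, of _ 1] assms(5)
    by (auto simp: antiderivative_on_def p_def eval_nat_numeral)

  have I_derivs: "(deriv ^^ n) I q = p n q" if "n \<le> 3" "q \<in> S" for n q
    using iterated_deriv_eq_on_open[OF \<open>open S\<close> I p] that by blast
  have I_diff: "(deriv ^^ n) I differentiable (at q)" if "n < 3" "q \<in> S" for n q
    using iterated_deriv_differentiable_on_open[OF \<open>open S\<close> I p] that by blast
  have k: "k \<noteq> 6" "k \<noteq> - 6"
    using \<open>k\<^sup>2 = (2/3)\<^sup>2\<close> by (auto simp: power2_eq_square)
  define sextic where "sextic q =
      10 * d 4 q * (d 0 q) ^ 3 - 80 * (d 0 q)\<^sup>2 * d 1 q * d 3 q - 51 * (d 0 q)\<^sup>2 * (d 2 q)\<^sup>2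
      + 336 * d 0 q * (d 1 q)\<^sup>2 * d 2 q - 224 * (d 1 q) ^ 4" for q
  define chazy where "chazy q =
      p 3 q - 2 * p 0 q * p 2 q + 3 * (p 1 q)\<^sup>2
      - 4 / (36 - k\<^sup>2) * (6 * p 1 q - (p 0 q)\<^sup>2)\<^sup>2" for q
  have "sextic q = 5 * d 0 q ^ 4 * chazy q" if "q \<in> S" for q
  proof -
    have dr: "d n q = r n q * d 0 q" for n
      using pos[OF that] by (simp add: r_def)
    have p_list: "p n q = log_deriv_poly (\<lambda>m. [1, r 1 q, r 2 q, r 3 q, r 4 q] ! m) n"
      if "n \<le> 3" for n
    proof -
      consider "n = 0" | "n = Suc 0" | "n = Suc (Suc 0)" | "n = Suc (Suc (Suc 0))"
        using \<open>n \<le> 3\<close> by linarith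
      then show ?thesis by cases (simp_all add: p_def)
    qed
    show ?thesis
      unfolding sextic_def chazy_def \<open>k\<^sup>2 = (2/3)\<^sup>2\<close> dr[of 1] dr[of 2] dr[of 3] dr[of 4]
      using sextic_eq_chazy[of "r 4 q" "d 0 q" "r 1 q" "r 3 q" "r 2 q"]
      by (simp only: p_list)
  qed
  then have "sextic q = 0 \<longleftrightarrow> chazy q = 0" if "q \<in> S" for q
    using that pos[OF that] by simp
  moreover have "generalised_chazy k S I \<longleftrightarrow> (\<forall>q\<in>S. chazy q = 0)"
    using k I_diff I I_derivs[of 1] I_derivs[of 2] I_derivs[of 3]
    by (simp add: generalised_chazy_def chazy_def)
  ultimately have "(\<forall>q\<in>S. sextic q = 0) \<longleftrightarrow> generalised_chazy k S I"
    by blast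
  then show ?thesis
    using integrals unfolding sextic_def d_eqs by blast
qed

end
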